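(* For all integers $n\ge l\ge 0$, $${n \brace l}_{Y,\lambda}=\sum_{k=l}^{n}(-1)^{n-k}S_{1,\lambda}^{Y}(n,k){k \brace l}_{-\lambda},$$ and $$(-1)^{n-l}S_{1,\lambda}^{Y}(n,l)=\sum_{k=l}^{n}{n\brace k}_{Y,\lambda}S_{1,-\lambda}(k,l).$$
   Context: $\lambda$ is a fixed nonzero real number. For real $x$, real $\mu\ne0$ and $n\ge1$: $(x)_{n}=x(x-1)\cdots(x-n+1)$, $(x)_{n,\mu}=x(x-\mu)\cdots(x-(n-1)\mu)$, and $(x)_0=(x)_{0,\mu}=1$. The degenerate exponential is $e_{\lambda}^{x}(t)=(1+\lambda t)^{x/\lambda}=\sum_{n\ge0}(x)_{n,\lambda}\frac{t^n}{n!}$. The degenerate logarithm is, for $\mu\ne0$ and $u>0$, $\log_{\mu}(u)=\frac{1}{\mu}(u^{\mu}-1)$; in particular $\log_{-\lambda}(u)=-\frac1\lambda(u^{-\lambda}-1)$. For any nonzero real $\mu$, the degenerate Stirling numbers of the first kind $S_{1,\mu}(n,k)$ and of the second kind ${n\brace k}_{\mu}$ are defined by the polynomial identities in $x$: $(x)_n=\sum_{k=0}^nS_{1,\mu}(n,k)(x)_{k,\mu}$ and $(x)_{n,\mu}=\sum_{k=0}^n{n\brace k}_\mu(x)_k$, $n\ge0$. $Y$ is a real random variable whose degenerate moment generating functions exist near the origin: for every nonzero real $\lambda$ there is $r=r(\lambda)>0$ with $E[e_{\lambda}^{Y}(t)]=\sum_{n\ge0}E[(Y)_{n,\lambda}]\frac{t^n}{n!}$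 for $|t|<r$. All generating-function identities are power series expansions at $t=0$. Probabilistic degenerate Stirling numbers of the second kind: $\frac{1}{k!}\big(E[e_{\lambda}^{Y}(t)]-1\big)^k=\sum_{n\ge k}{n\brace k}_{Y,\lambda}\frac{t^n}{n!}$, $k\ge0$. Probabilistic degenerate Stirling numbers of the first kind: $\frac{1}{k!}\big(\log_{-\lambda}(E[e_{\lambda}^{Y}(t)])\big)^k=\sum_{n\ge k}(-1)^{n-k}S_{1,\lambda}^{Y}(n,k)\frac{t^n}{n!}$, $k\ge0$. *)

theory Defs
  imports "HOL-Probability.Probability"
begin

definition falling_fact :: "real \<Rightarrow> nat \<Rightarrow> real"
  where "falling_fact x n = (\<Prod>i<n. x - real i)"

definition deg_falling_fact :: "real \<Rightarrow> real \<Rightarrow> nat \<Rightarrow> real"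
  where "deg_falling_fact \<mu> x n = (\<Prod>i<n. x - real i * \<mu>)"

text \<open>The closed form of the degenerate exponential is meant for \<open>1 + \<mu> * t > 0\<close>, i.e. for
  \<open>t\<close> near the origin; only the germ at \<open>t = 0\<close> is ever used.\<close>

definition deg_exp :: "real \<Rightarrow> real \<Rightarrow> real \<Rightarrow> real"
  where "deg_exp \<mu> x t = (1 + \<mu> * t) powr (x / \<mu>)"

definition deg_log :: "real \<Rightarrow> real \<Rightarrow> real"
  where "deg_log \<mu> u = 1 / \<mu> * (u powr \<mu> - 1)"


text \<open>The coefficients in the defining polynomial identities are unique once they are set to
  \<open>0\<close> outside the range \<open>k \<le> n\<close>; see \<open>deg_stirling1_identity\<close>, \<open>deg_stirling2_identity\<close>
  and the corresponding uniqueness rules below.\<close>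

definition deg_stirling1 :: "real \<Rightarrow> nat \<Rightarrow> nat \<Rightarrow> real"
  where "deg_stirling1 \<mu> n =
    (THE c. (\<forall>k>n. c k = 0) \<and>
            (\<forall>x. falling_fact x n = (\<Sum>k\<le>n. c k * deg_falling_fact \<mu> x k)))"

definition deg_stirling2 :: "real \<Rightarrow> nat \<Rightarrow> nat \<Rightarrow> real"
  where "deg_stirling2 \<mu> n =
    (THE c. (\<forall>k>n. c k = 0) \<and>
            (\<forall>x. deg_falling_fact \<mu> x n = (\<Sum>k\<le>n. c k * falling_fact x k)))"


text \<open>The sequence \<open>a\<close> with \<open>f t = (\<Sum>n. a n * t ^ n / n!)\<close> near \<open>t = 0\<close>.\<close>

definition egf_coeff :: "(real \<Rightarrow> real) \<Rightarrow> nat \<Rightarrow> real"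
  where "egf_coeff f = (THE a. f has_fps_expansion Abs_fps (\<lambda>n. a n / fact n))"

definition deg_mgf :: "'a measure \<Rightarrow> ('a \<Rightarrow> real) \<Rightarrow> real \<Rightarrow> real \<Rightarrow> real"
  where "deg_mgf M Y \<mu> t = (\<integral>\<omega>. deg_exp \<mu> (Y \<omega>) t \<partial>M)"


text \<open>Integrability is demanded explicitly because the Bochner integral of a non-integrable
  function is \<open>0\<close>.\<close>

definition deg_mgfs_exist :: "'a measure \<Rightarrow> ('a \<Rightarrow> real) \<Rightarrow> bool"
  where "deg_mgfs_exist M Y \<longleftrightarrow>
    (\<forall>\<mu>. \<mu> \<noteq> 0 \<longrightarrow>
      (\<forall>n. integrable M (\<lambda>\<omega>. deg_falling_fact \<mu> (Y \<omega>) n)) \<and>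
      (\<exists>r>0. \<forall>t. \<bar>t\<bar> < r \<longrightarrow>
        integrable M (\<lambda>\<omega>. deg_exp \<mu> (Y \<omega>) t) \<and>
        (\<lambda>n. (\<integral>\<omega>. deg_falling_fact \<mu> (Y \<omega>) n \<partial>M) * t ^ n / fact n) sums deg_mgf M Y \<mu> t))"

text \<open>Since \<open>deg_mgf M Y \<mu> 0 = 1\<close>, both bases below vanish at \<open>t = 0\<close>, so the coefficients with
  \<open>n < k\<close> are \<open>0\<close> and the expansions start at \<open>n = k\<close>.\<close>

definition prob_deg_stirling2 :: "'a measure \<Rightarrow> ('a \<Rightarrow> real) \<Rightarrow> real \<Rightarrow> nat \<Rightarrow> nat \<Rightarrow> real"
  where "prob_deg_stirling2 M Y \<mu> n k =
    egf_coeff (\<lambda>t. 1 / fact k * (deg_mgf M Y \<mu> t - 1) ^ k) n"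

text \<open>The generating function has coefficients \<open>(-1) ^ (n - k) * S n k\<close>; the sign is its own
  inverse.\<close>

definition prob_deg_stirling1 :: "'a measure \<Rightarrow> ('a \<Rightarrow> real) \<Rightarrow> real \<Rightarrow> nat \<Rightarrow> nat \<Rightarrow> real"
  where "prob_deg_stirling1 M Y \<mu> n k =
    (-1) ^ (n - k) * egf_coeff (\<lambda>t. 1 / fact k * (deg_log (-\<mu>) (deg_mgf M Y \<mu> t)) ^ k) n"


lemma falling_fact_eq: "falling_fact x n = deg_falling_fact 1 x n"
  by (simp add: falling_fact_def deg_falling_fact_def)

lemma deg_falling_fact_Suc:
  "deg_falling_fact \<mu> x (Suc n) = deg_falling_fact \<mu> x n * (x - real n * \<mu>)"
  by (simp add: deg_falling_fact_def)

lemma deg_falling_fact_connection_ex: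
  "\<exists>c. (\<forall>k>n. c k = 0) \<and> (\<forall>x. deg_falling_fact a x n = (\<Sum>k\<le>n. c k * deg_falling_fact b x k))"
proof (induction n)
  case 0
  show ?case
    by (rule exI[of _ "\<lambda>k. if k = 0 then 1 else 0"]) (simp add: deg_falling_fact_def)
next
  case (Suc n)
  then obtain c where c0: "\<And>k. k > n \<Longrightarrow> c k = 0"
    and c: "\<And>x. deg_falling_fact a x n = (\<Sum>k\<le>n. c k * deg_falling_fact b x k)" by blast
  define d where
    "d k = (if k = 0 then 0 else c (k - 1)) + (real k * b - real n * a) * c k" for k
  have "deg_falling_fact a x (Suc n) = (\<Sum>k\<le>Suc n. d k * deg_falling_fact b x k)" for x
  proof -
    have "deg_falling_fact a x (Suc n) =
        (\<Sum>k\<le>n. c k * deg_falling_fact b x (Suc k)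
           + (real k * b - real n * a) * c k * deg_falling_fact b x k)"
      unfolding deg_falling_fact_Suc c sum_distrib_right
      by (intro sum.cong) (auto simp: algebra_simps)
    also have "\<dots> = (\<Sum>k\<le>n. c k * deg_falling_fact b x (Suc k))
        + (\<Sum>k\<le>Suc n. (real k * b - real n * a) * c k * deg_falling_fact b x k)"
      by (simp add: sum.distrib c0)
    also have "(\<Sum>k\<le>n. c k * deg_falling_fact b x (Suc k)) =
        (\<Sum>k\<le>Suc n. (if k = 0 then 0 else c (k - 1)) * deg_falling_fact b x k)"
      by (subst sum.atMost_Suc_shift) simp
    finally show ?thesis
      by (simp only: d_def sum.distrib[symmetric] distrib_right)
  qed
  moreover have "\<forall>k>Suc n. d k = 0" by (auto simp: d_def c0)
  ultimately show ?case by blast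
qed

lemma deg_falling_fact_lin_indep:
  assumes "b \<noteq> 0" and "\<And>x. (\<Sum>k\<le>n. d k * deg_falling_fact b x k) = 0" and "m \<le> n"
  shows "d m = 0"
  using assms(3)
proof (induction m rule: less_induct)
  case (less m)
  have "0 = (\<Sum>k\<le>n. d k * deg_falling_fact b (real m * b) k)"
    using assms(2) by simp
  also have "\<dots> = (\<Sum>k\<in>{m}. d k * deg_falling_fact b (real m * b) k)"
  proof (rule sum.mono_neutral_right)
    show "\<forall>k\<in>{..n} - {m}. d k * deg_falling_fact b (real m * b) k = 0"
    proof
      fix k assume k: "k \<in> {..n} - {m}"
      show "d k * deg_falling_fact b (real m * b) k = 0"
      proof (cases "k < m")
        case True
        with less show ?thesis by auto
      next
        case False
        with k have "m < k" by auto
        then have "deg_falling_fact b (real m * b) k = 0"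
          unfolding deg_falling_fact_def by (intro prod_zero) auto
        then show ?thesis by simp
      qed
    qed
  qed (use less.prems in auto)
  finally have "d m * deg_falling_fact b (real m * b) m = 0" by simp
  moreover have "deg_falling_fact b (real m * b) m \<noteq> 0"
    using assms(1) by (auto simp: deg_falling_fact_def)
  ultimately show ?case by simp
qed

lemma deg_falling_fact_connection_unique:
  assumes "b \<noteq> 0"
    and "(\<forall>k>n. c k = 0) \<and> (\<forall>x. f x = (\<Sum>k\<le>n. c k * deg_falling_fact b x k))"
    and "(\<forall>k>n. c' k = 0) \<and> (\<forall>x. f x = (\<Sum>k\<le>n. c' k * deg_falling_fact b x k))"
  shows "c = c'"
proof
  fix m
  have "(\<Sum>k\<le>n. (c k - c' k) * deg_falling_fact b x k) = 0" for x
  proof -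
    have "(\<Sum>k\<le>n. (c k - c' k) * deg_falling_fact b x k) = f x - f x"
      unfolding left_diff_distrib sum_subtractf using assms(2,3) by metis
    then show ?thesis by simp
  qed
  then have "c m - c' m = 0" if "m \<le> n"
    using deg_falling_fact_lin_indep[OF assms(1) _ that, of "\<lambda>k. c k - c' k"] by blast
  moreover have "c m = c' m" if "m > n" using that assms(2,3) by metis
  ultimately show "c m = c' m" by (cases "m \<le> n") (simp_all add: not_le)
qed

lemma
  assumes "\<mu> \<noteq> 0"
  shows deg_stirling1_identity:
      "falling_fact x n = (\<Sum>k\<le>n. deg_stirling1 \<mu> n k * deg_falling_fact \<mu> x k)"
    and deg_stirling1_eq_0: "n < k \<Longrightarrow> deg_stirling1 \<mu> n k = 0"
    and deg_stirling1_unique: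
      "\<lbrakk>\<And>k. n < k \<Longrightarrow> c k = 0;
        \<And>x. falling_fact x n = (\<Sum>k\<le>n. c k * deg_falling_fact \<mu> x k)\<rbrakk> \<Longrightarrow> deg_stirling1 \<mu> n = c"
proof -
  let ?P = "\<lambda>c. (\<forall>k>n. c k = 0) \<and>
    (\<forall>x. falling_fact x n = (\<Sum>k\<le>n. c k * deg_falling_fact \<mu> x k))"
  have ex1: "\<exists>!c. ?P c"
    by (rule ex_ex1I, unfold falling_fact_eq, rule deg_falling_fact_connection_ex)
       (erule (1) deg_falling_fact_connection_unique[OF assms])
  have "?P (deg_stirling1 \<mu> n)" unfolding deg_stirling1_def by (rule theI'[OF ex1])
  then show "falling_fact x n = (\<Sum>k\<le>n. deg_stirling1 \<mu> n k * deg_falling_fact \<mu> x k)"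
    and "n < k \<Longrightarrow> deg_stirling1 \<mu> n k = 0" by blast+
  show "deg_stirling1 \<mu> n = c" if "\<And>k. n < k \<Longrightarrow> c k = 0"
    "\<And>x. falling_fact x n = (\<Sum>k\<le>n. c k * deg_falling_fact \<mu> x k)"
    unfolding deg_stirling1_def using that by (intro the1_equality[OF ex1]) blast
qed

lemma
  shows deg_stirling2_identity:
      "deg_falling_fact \<mu> x n = (\<Sum>k\<le>n. deg_stirling2 \<mu> n k * falling_fact x k)"
    and deg_stirling2_eq_0: "n < k \<Longrightarrow> deg_stirling2 \<mu> n k = 0"
    and deg_stirling2_unique:
      "\<lbrakk>\<And>k. n < k \<Longrightarrow> c k = 0;
        \<And>x. deg_falling_fact \<mu> x n = (\<Sum>k\<le>n. c k * falling_fact x k)\<rbrakk> \<Longrightarrow> deg_stirling2 \<mu> n = c"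
proof -
  let ?P = "\<lambda>c. (\<forall>k>n. c k = 0) \<and>
    (\<forall>x. deg_falling_fact \<mu> x n = (\<Sum>k\<le>n. c k * falling_fact x k))"
  have ex1: "\<exists>!c. ?P c"
    by (rule ex_ex1I, unfold falling_fact_eq, rule deg_falling_fact_connection_ex)
       (erule (1) deg_falling_fact_connection_unique[OF one_neq_zero])
  have "?P (deg_stirling2 \<mu> n)" unfolding deg_stirling2_def by (rule theI'[OF ex1])
  then show "deg_falling_fact \<mu> x n = (\<Sum>k\<le>n. deg_stirling2 \<mu> n k * falling_fact x k)"
    and "n < k \<Longrightarrow> deg_stirling2 \<mu> n k = 0" by blast+
  show "deg_stirling2 \<mu> n = c" if "\<And>k. n < k \<Longrightarrow> c k = 0"
    "\<And>x. deg_falling_fact \<mu> x n = (\<Sum>k\<le>n. c k * falling_fact x k)"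
    unfolding deg_stirling2_def using that by (intro the1_equality[OF ex1]) blast
qed

text \<open>Uniqueness of power series expansions, which the library states only over the complex
  numbers.\<close>

lemma has_fps_expansion_real_unique:
  fixes F G :: "real fps"
  assumes "f has_fps_expansion F" and "f has_fps_expansion G"
  shows "F = G"
proof -
  have "fps_nth H n = 0" if "(\<lambda>_. 0) has_fps_expansion H" for H :: "real fps" and n
    using that
  proof (induction n arbitrary: H)
    case 0
    then have "eval_fps H 0 = 0"
      unfolding has_fps_expansion_def by (blast dest: eventually_nhds_x_imp_x)
    then show ?case by (simp add: eval_fps_at_0)
  next
    case (Suc n H)
    have rad: "fps_conv_radius H > 0" and ev: "\<forall>\<^sub>F z in nhds 0. eval_fps H z = 0"
      using Suc.prems by (auto simp: has_fps_expansion_def)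
    have "\<forall>\<^sub>F z in nhds (0::real). z \<in> eball 0 (fps_conv_radius H)"
      using rad by (intro eventually_nhds_in_open) (auto simp: zero_ereal_def)
    moreover from ev have "\<forall>\<^sub>F y in nhds 0. \<forall>\<^sub>F z in nhds y. eval_fps H z = 0"
      by (simp only: eventually_eventually)
    ultimately have "\<forall>\<^sub>F z in nhds 0. eval_fps (fps_deriv H) z = 0"
    proof eventually_elim
      case (elim z)
      have "eval_fps (fps_deriv H) z = deriv (eval_fps H) z"
        using elim(1) by (intro eval_fps_deriv) simp
      also have "\<dots> = deriv (\<lambda>_. 0) z"
        by (rule deriv_cong_ev) (use elim(2) in auto)
      finally show ?case by simp
    qed
    then have "(\<lambda>_. 0) has_fps_expansion fps_deriv H"
      using rad fps_conv_radius_deriv[of H] by (auto simp: has_fps_expansion_def)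
    from Suc.IH[OF this] show ?case by (simp add: fps_deriv_def del: of_nat_Suc)
  qed
  moreover have "(\<lambda>_. 0) has_fps_expansion F - G"
    using has_fps_expansion_diff[OF assms] by simp
  ultimately have "fps_nth (F - G) n = 0" for n by blast
  then show ?thesis by (intro fps_ext) simp
qed

lemma egf_coeff_eq:
  assumes "f has_fps_expansion F"
  shows "egf_coeff f n = fact n * fps_nth F n"
proof -
  have "egf_coeff f = (\<lambda>n. fact n * fps_nth F n)"
    unfolding egf_coeff_def
  proof (rule the_equality)
    show "f has_fps_expansion Abs_fps (\<lambda>n. fact n * fps_nth F n / fact n)"
      using assms by (simp add: fps_nth_inverse)
  next
    fix a assume "f has_fps_expansion Abs_fps (\<lambda>n. a n / fact n)"
    then have "F = Abs_fps (\<lambda>n. a n / fact n)"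
      by (rule has_fps_expansion_real_unique[OF assms])
    then show "a = (\<lambda>n. fact n * fps_nth F n)" by simp
  qed
  then show ?thesis by simp
qed

end

theory Submission
  imports Defs "HOL-Complex_Analysis.Laurent_Convergence"
begin

text \<open>Write \<open>E\<^sub>a(x)\<close> for the power series with coefficients \<open>(x)\<^bsub>n,a\<^esub> / n!\<close> and put
  \<open>V\<^sub>a\<^sub>,\<^sub>b = (E\<^sub>a(b) - 1) / b\<close>. The equation \<open>(1 + a t) E' = x E\<close> characterises \<open>E\<^sub>a(x)\<close>, whence
  \<open>E\<^sub>b(x) \<circ> V\<^sub>a\<^sub>,\<^sub>b = E\<^sub>a(x)\<close>. Comparing coefficients, both kinds of degenerate Stirling numbers are
  \<open>n! [t\<^sup>n] V\<^sub>a\<^sub>,\<^sub>b\<^sup>k / k!\<close>, with \<open>(a, b) = (1, \<mu>)\<close> for the first kind and \<open>(\<mu>, 1)\<close> for the second.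
  The series \<open>V\<^sub>1\<^sub>,\<^sub>\<mu>\<close> (the degenerate logarithm) and \<open>V\<^sub>\<mu>\<^sub>,\<^sub>1\<close> are compositional inverses, so the bases
  \<open>P\<close> and \<open>G\<close> of the two probabilistic generating functions satisfy \<open>G = V\<^sub>1\<^sub>,\<^sub>\<mu> \<circ> P\<close> and
  \<open>P = V\<^sub>\<mu>\<^sub>,\<^sub>1 \<circ> G\<close> for \<open>\<mu> = -\<lambda>\<close>; the two claims are these identities raised to the power \<open>l\<close>.\<close>

section \<open>Composition of real power series expansions, by passing to complex series\<close>

definition fps_complex_of_real :: "real fps \<Rightarrow> complex fps"
  where "fps_complex_of_real F = Abs_fps (\<lambda>n. of_real (fps_nth F n))"

lemma fps_nth_complex_of_real [simp]:
  "fps_nth (fps_complex_of_real F) n = of_real (fps_nth F n)"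
  by (simp add: fps_complex_of_real_def)

lemma fps_complex_of_real_mult:
  "fps_complex_of_real (F * G) = fps_complex_of_real F * fps_complex_of_real G"
  by (simp add: fps_eq_iff fps_mult_nth)

lemma fps_complex_of_real_power:
  "fps_complex_of_real (F ^ n) = fps_complex_of_real F ^ n"
  by (induction n) (auto simp: fps_complex_of_real_mult, simp add: fps_eq_iff)

lemma fps_complex_of_real_compose:
  "fps_complex_of_real (F oo G) = fps_complex_of_real F oo fps_complex_of_real G"
  by (simp add: fps_eq_iff fps_compose_nth flip: fps_complex_of_real_power)

lemma fps_conv_radius_complex_of_real [simp]:
  "fps_conv_radius (fps_complex_of_real F) = fps_conv_radius F"
  unfolding fps_conv_radius_def conv_radius_def by simp

lemma eval_fps_complex_of_real:
  assumes "ereal \<bar>x\<bar> < fps_conv_radius F"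
  shows "eval_fps (fps_complex_of_real F) (of_real x) = of_real (eval_fps F x)"
  using summable_fps[of x F] assms
  by (simp add: eval_fps_def flip: of_real_power of_real_mult suminf_of_real)

text \<open>The library has the following only over the complex numbers.\<close>

lemma has_fps_expansion_compose_real:
  fixes F G :: "real fps"
  assumes f: "f has_fps_expansion F" and g: "g has_fps_expansion G" and G0: "fps_nth G 0 = 0"
  shows "(\<lambda>x. f (g x)) has_fps_expansion (F oo G)"
proof -
  let ?c = fps_complex_of_real
  have posF: "fps_conv_radius F > 0" and posG: "fps_conv_radius G > 0"
    and evF: "\<forall>\<^sub>F x in nhds 0. eval_fps F x = f x" and evG: "\<forall>\<^sub>F x in nhds 0. eval_fps G x = g x"
    using f g by (auto simp: has_fps_expansion_def)
  have "(eval_fps (?c F) \<circ> eval_fps (?c G)) has_fps_expansion (?c F oo ?c G)"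
    by (intro has_fps_expansion_compose eval_fps_has_fps_expansion) (use posF posG G0 in auto)
  then have posFG: "fps_conv_radius (F oo G) > 0"
    and ev: "\<forall>\<^sub>F z in nhds 0. eval_fps (?c (F oo G)) z = eval_fps (?c F) (eval_fps (?c G) z)"
    by (simp_all add: has_fps_expansion_def flip: fps_complex_of_real_compose)
  have in_ball: "\<forall>\<^sub>F x in nhds (0::real). ereal \<bar>x\<bar> < fps_conv_radius H"
    if "fps_conv_radius H > 0" for H :: "real fps"
  proof -
    have "\<forall>\<^sub>F x in nhds (0::real). x \<in> eball 0 (fps_conv_radius H)"
      using that by (intro eventually_nhds_in_open) (auto simp: zero_ereal_def)
    then show ?thesis by simp
  qed
  \<comment> \<open>The identity \<open>ev\<close> holds near the complex origin; the embedding of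
    the reals is continuous there, so it restricts to real arguments.\<close>
  have "filterlim complex_of_real (nhds 0) (nhds 0)"
    using tendsto_of_real[OF tendsto_ident_at[of "0::real" UNIV]]
    by (metis tendsto_at_iff_tendsto_nhds of_real_0)
  from eventually_compose_filterlim[OF ev this]
  have ev': "\<forall>\<^sub>F x in nhds (0::real). eval_fps (?c (F oo G)) (of_real x) =
      eval_fps (?c F) (eval_fps (?c G) (of_real x))" .
  have "isCont g 0" using has_fps_expansion_imp_continuous[OF g] .
  moreover have "g 0 = 0"
    using eventually_nhds_x_imp_x[OF evG] G0 by (simp add: eval_fps_at_0)
  \<comment> \<open>This puts \<open>g x\<close> into the convergence disc of \<open>F\<close> for
    small \<open>x\<close>, as needed to evaluate the embedded series at \<open>g x\<close>.\<close>
  ultimately have g_lim: "filterlim g (nhds 0) (nhds 0)"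
    using tendsto_at_iff_tendsto_nhds[of g 0] by (simp add: isCont_def)
  have "\<forall>\<^sub>F x in nhds 0. eval_fps (F oo G) x = f (g x)"
    using ev' evG in_ball[OF posFG] in_ball[OF posG]
      eventually_compose_filterlim[OF evF g_lim]
      eventually_compose_filterlim[OF in_ball[OF posF] g_lim]
  proof eventually_elim
    case (elim x)
    then have "complex_of_real (eval_fps (F oo G) x) = of_real (f (g x))"
      by (simp add: eval_fps_complex_of_real)
    then show ?case by (simp only: of_real_eq_iff)
  qed
  with posFG show ?thesis by (simp add: has_fps_expansion_def)
qed

section \<open>Degenerate exponential series and change of step\<close>

definition deg_exp_fps :: "real \<Rightarrow> real \<Rightarrow> real fps"
  where "deg_exp_fps a x = Abs_fps (\<lambda>n. deg_falling_fact a x n / fact n)"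

lemma deg_exp_fps_nth: "fps_nth (deg_exp_fps a x) n = deg_falling_fact a x n / fact n"
  by (simp add: deg_exp_fps_def)

lemma deg_exp_fps_nth_0 [simp]: "fps_nth (deg_exp_fps a x) 0 = 1"
  by (simp add: deg_exp_fps_def deg_falling_fact_def)

text \<open>Compares coefficients of \<open>t^n\<close>. The resulting first-order recurrence
  determines \<open>F\<close> from its constant term.\<close>

lemma deg_exp_fps_ode_iff:
  "(1 + fps_const a * fps_X) * fps_deriv F = fps_const x * F
     \<longleftrightarrow> (\<forall>n. real (Suc n) * fps_nth F (Suc n) = (x - real n * a) * fps_nth F n)"
proof -
  have "fps_nth ((1 + fps_const a * fps_X) * fps_deriv F) n =
      real (Suc n) * fps_nth F (Suc n) + a * (real n * fps_nth F n)" for n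
    by (cases n) (simp_all add: distrib_right mult.assoc)
  then show ?thesis by (auto simp: fps_eq_iff algebra_simps)
qed

lemma deg_exp_fps_ode:
  "(1 + fps_const a * fps_X) * fps_deriv (deg_exp_fps a x) = fps_const x * deg_exp_fps a x"
  unfolding deg_exp_fps_ode_iff
  by (simp add: deg_exp_fps_nth deg_falling_fact_Suc divide_simps del: of_nat_Suc)

lemma deg_exp_fps_unique:
  assumes ode: "(1 + fps_const a * fps_X) * fps_deriv F = fps_const x * F" and "fps_nth F 0 = 1"
  shows "F = deg_exp_fps a x"
proof (rule fps_ext)
  fix n show "fps_nth F n = fps_nth (deg_exp_fps a x) n"
  proof (induction n)
    case (Suc n)
    have "real (Suc n) * fps_nth F (Suc n) = real (Suc n) * fps_nth (deg_exp_fps a x) (Suc n)"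
      using ode deg_exp_fps_ode[of a x] Suc unfolding deg_exp_fps_ode_iff by simp
    then show ?case by (simp del: of_nat_Suc)
  qed (simp add: assms)
qed

definition deg_conn_fps :: "real \<Rightarrow> real \<Rightarrow> real fps"
  where "deg_conn_fps a b = fps_const (1 / b) * (deg_exp_fps a b - 1)"

lemma deg_conn_fps_nth_0 [simp]: "fps_nth (deg_conn_fps a b) 0 = 0"
  by (simp add: deg_conn_fps_def)

text \<open>For nonzero \<open>a\<close>, formally \<open>1 + b V = (1 + a t)^(b/a)\<close>, whose
  power \<open>x/b\<close> is \<open>(1 + a t)^(x/a)\<close>. The proof avoids powers:
  \<open>(1 + a t) V' = 1 + b V\<close> and the chain rule show that the composite solves the
  equation of \<open>deg_exp_fps a x\<close>.\<close>

lemma deg_exp_fps_compose_conn: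
  assumes "b \<noteq> 0"
  shows "deg_exp_fps b x oo deg_conn_fps a b = deg_exp_fps a x"
proof (rule deg_exp_fps_unique)
  let ?V = "deg_conn_fps a b" and ?E = "deg_exp_fps b x"
  have bV: "1 + fps_const b * ?V = deg_exp_fps a b"
    using assms by (simp add: deg_conn_fps_def flip: mult.assoc)
  have "(1 + fps_const a * fps_X) * fps_deriv ?V =
      fps_const (1 / b) * ((1 + fps_const a * fps_X) * fps_deriv (deg_exp_fps a b))"
    by (simp add: deg_conn_fps_def mult_ac)
  also have "\<dots> = deg_exp_fps a b"
    using assms by (simp add: deg_exp_fps_ode flip: mult.assoc)
  finally have dV: "(1 + fps_const a * fps_X) * fps_deriv ?V = 1 + fps_const b * ?V"
    by (simp only: bV)
  have "(1 + fps_const a * fps_X) * fps_deriv (?E oo ?V) =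
      (1 + fps_const b * ?V) * (fps_deriv ?E oo ?V)"
    by (simp add: fps_compose_deriv mult_ac flip: dV)
  also have "\<dots> = ((1 + fps_const b * fps_X) * fps_deriv ?E) oo ?V"
    by (simp add: fps_compose_mult_distrib fps_compose_add_distrib)
  also have "\<dots> = fps_const x * (?E oo ?V)"
    by (simp add: deg_exp_fps_ode fps_compose_mult_distrib)
  finally show "(1 + fps_const a * fps_X) * fps_deriv (?E oo ?V) = fps_const x * (?E oo ?V)" .
qed simp

text \<open>Changes of step from \<open>a\<close> to \<open>b\<close> to \<open>c\<close> compose;
  \<open>c = a\<close> together with \<open>deg_conn_fps_refl\<close> yields compositional
  inverses.\<close>

lemma deg_conn_fps_compose:
  assumes "b \<noteq> 0"
  shows "deg_conn_fps b c oo deg_conn_fps a b = deg_conn_fps a c"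
  by (simp add: deg_conn_fps_def[of _ c] fps_compose_mult_distrib fps_compose_sub_distrib
      deg_exp_fps_compose_conn[OF assms])

lemma deg_conn_fps_refl: "a \<noteq> 0 \<Longrightarrow> deg_conn_fps a a = fps_X"
proof (rule fps_ext)
  fix n assume "a \<noteq> 0"
  \<comment> \<open>The factor with index 1 is \<open>a - a\<close>, so only degrees 0 and 1 can
    survive.\<close>
  moreover have "deg_falling_fact a a (Suc (Suc m)) = 0" for m
    unfolding deg_falling_fact_def by (intro prod_zero) (auto intro!: bexI[of _ 1])
  ultimately show "fps_nth (deg_conn_fps a a) n = fps_nth fps_X n"
    by (cases n rule: nat.exhaust; cases "n - 1")
       (auto simp: deg_conn_fps_def deg_exp_fps_nth deg_falling_fact_def)
qed

section \<open>Stirling numbers as coefficients of powers\<close>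

lemma deg_falling_fact_connection:
  assumes "b \<noteq> 0"
  shows "deg_falling_fact a x n =
    (\<Sum>k\<le>n. (fact n * fps_nth (deg_conn_fps a b ^ k) n / fact k) * deg_falling_fact b x k)"
proof -
  have "deg_falling_fact a x n = fact n * fps_nth (deg_exp_fps b x oo deg_conn_fps a b) n"
    by (simp add: deg_exp_fps_compose_conn[OF assms] deg_exp_fps_nth)
  then show ?thesis
    by (simp add: fps_compose_nth deg_exp_fps_nth sum_distrib_left atLeast0AtMost mult_ac)
qed

text \<open>Uniqueness applies because the \<open>k\<close>-th power of a series without constant
  term starts at degree \<open>k\<close>, which gives the required zeros for
  \<open>k > n\<close>.\<close>

lemma deg_stirling1_eq_fps:
  assumes "\<mu> \<noteq> 0"
  shows "deg_stirling1 \<mu> n k = fact n * fps_nth (deg_conn_fps 1 \<mu> ^ k) n / fact k"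
  by (rule fun_cong[OF deg_stirling1_unique[OF assms]])
     (simp_all add: startsby_zero_power_prefix falling_fact_eq
       deg_falling_fact_connection[OF assms, of 1])

lemma deg_stirling2_eq_fps:
  "deg_stirling2 \<mu> n k = fact n * fps_nth (deg_conn_fps \<mu> 1 ^ k) n / fact k"
  by (rule fun_cong[OF deg_stirling2_unique])
     (simp_all add: startsby_zero_power_prefix falling_fact_eq
       deg_falling_fact_connection[of 1 \<mu>])

text \<open>Expands \<open>V^l oo U = (V oo U)^l\<close>; terms with \<open>k < l\<close> vanish
  since \<open>V^l\<close> starts at degree \<open>l\<close>. Both claims of the theorem are
  instances.\<close>

lemma fps_power_compose_coeff:
  fixes U V :: "real fps"
  assumes U0: "fps_nth U 0 = 0" and V0: "fps_nth V 0 = 0"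
  shows "fact n * fps_nth ((V oo U) ^ l) n / fact l =
    (\<Sum>k=l..n. (fact n * fps_nth (U ^ k) n / fact k) * (fact k * fps_nth (V ^ l) k / fact l))"
proof -
  have "fps_nth ((V oo U) ^ l) n = (\<Sum>k=0..n. fps_nth (V ^ l) k * fps_nth (U ^ k) n)"
    by (simp add: fps_compose_power[OF U0] fps_compose_nth)
  also have "\<dots> = (\<Sum>k=l..n. fps_nth (V ^ l) k * fps_nth (U ^ k) n)"
    by (rule sum.mono_neutral_right) (auto simp: startsby_zero_power_prefix[OF V0])
  finally show ?thesis
    by (simp add: sum_distrib_left sum_divide_distrib mult_ac)
qed

section \<open>Analytic expansions of the generating functions\<close>

lemma has_fps_expansion_powr:
  "(\<lambda>z. (1 + z) powr x) has_fps_expansion deg_exp_fps 1 x"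
proof (rule has_fps_expansionI)
  have "\<forall>\<^sub>F z in nhds (0::real). z \<in> ball 0 1"
    by (intro eventually_nhds_in_open) auto
  then show "\<forall>\<^sub>F z in nhds 0. (\<lambda>n. fps_nth (deg_exp_fps 1 x) n * z ^ n) sums (1 + z) powr x"
  proof eventually_elim
    case (elim z)
    then show ?case
      using gen_binomial_real[of z x]
      by (simp add: deg_exp_fps_nth deg_falling_fact_def gbinomial_prod_rev atLeast0LessThan)
  qed
qed

lemma has_fps_expansion_deg_log:
  "(\<lambda>z. deg_log \<mu> (1 + z)) has_fps_expansion deg_conn_fps 1 \<mu>"
  unfolding deg_log_def deg_conn_fps_def
  by (intro has_fps_expansion_cmult_left has_fps_expansion_diff has_fps_expansion_powr
      has_fps_expansion_1)

lemma has_fps_expansion_power_real: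
  fixes F :: "real fps"
  assumes "f has_fps_expansion F"
  shows "(\<lambda>t. f t ^ k) has_fps_expansion F ^ k"
  by (induction k) (auto intro: has_fps_expansion_mult assms)

lemma egf_coeff_power:
  assumes "f has_fps_expansion F"
  shows "egf_coeff (\<lambda>t. 1 / fact k * f t ^ k) n = fact n * fps_nth (F ^ k) n / fact k"
  using egf_coeff_eq[OF has_fps_expansion_cmult_left[OF has_fps_expansion_power_real[OF assms]],
      of "1 / fact k" k n]
  by simp

lemma deg_mgf_has_fps_expansion:
  assumes "deg_mgfs_exist M Y" and "\<mu> \<noteq> 0"
  shows "deg_mgf M Y \<mu> has_fps_expansion
    Abs_fps (\<lambda>n. (\<integral>\<omega>. deg_falling_fact \<mu> (Y \<omega>) n \<partial>M) / fact n)"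
proof (rule has_fps_expansionI)
  obtain r where "r > 0" and r: "\<And>t. \<bar>t\<bar> < r \<Longrightarrow>
      (\<lambda>n. (\<integral>\<omega>. deg_falling_fact \<mu> (Y \<omega>) n \<partial>M) * t ^ n / fact n) sums deg_mgf M Y \<mu> t"
    using assms unfolding deg_mgfs_exist_def by blast
  from \<open>r > 0\<close> have "\<forall>\<^sub>F t in nhds (0::real). t \<in> ball 0 r"
    by (intro eventually_nhds_in_open) auto
  then show "\<forall>\<^sub>F t in nhds 0. (\<lambda>n. fps_nth (Abs_fps (\<lambda>n. (\<integral>\<omega>. deg_falling_fact \<mu> (Y \<omega>) n \<partial>M)
      / fact n)) n * t ^ n) sums deg_mgf M Y \<mu> t"
    by eventually_elim (use r in simp)
qed

theorem theorem2p4: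
  fixes M :: "'a measure" and Y :: "'a \<Rightarrow> real" and lam :: real and n l :: nat
  assumes "prob_space M"
    and "Y \<in> borel_measurable M"
    and "deg_mgfs_exist M Y"
    and "lam \<noteq> 0"
    and "l \<le> n"
  shows "prob_deg_stirling2 M Y lam n l =
           (\<Sum>k=l..n. (-1) ^ (n - k) * prob_deg_stirling1 M Y lam n k * deg_stirling2 (-lam) k l)
       \<and> (-1) ^ (n - l) * prob_deg_stirling1 M Y lam n l =
           (\<Sum>k=l..n. prob_deg_stirling2 M Y lam n k * deg_stirling1 (-lam) k l)"
proof -
  interpret prob_space M by fact
  define P where "P = Abs_fps (\<lambda>n. (\<integral>\<omega>. deg_falling_fact lam (Y \<omega>) n \<partial>M) / fact n) - 1"
  define G where "G = deg_conn_fps 1 (-lam) oo P"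
  \<comment> \<open>The zeroth coefficient of the moment series is the total mass 1.\<close>
  have P0: "fps_nth P 0 = 0"
    by (simp add: P_def deg_falling_fact_def prob_space)
  then have G0: "fps_nth G 0 = 0" by (simp add: G_def)
  have P: "(\<lambda>t. deg_mgf M Y lam t - 1) has_fps_expansion P"
    unfolding P_def using assms(3,4)
    by (intro has_fps_expansion_diff deg_mgf_has_fps_expansion has_fps_expansion_1)
  have G: "(\<lambda>t. deg_log (-lam) (deg_mgf M Y lam t)) has_fps_expansion G"
    using has_fps_expansion_compose_real[OF has_fps_expansion_deg_log[of "-lam"] P P0]
    by (simp add: G_def)
  \<comment> \<open>By associativity the outer series meets its inverse inside \<open>G\<close>,
    leaving \<open>fps_X oo P\<close>.\<close>
  have PG: "deg_conn_fps (-lam) 1 oo G = P"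
    using assms(4) P0 by (simp add: G_def fps_compose_assoc deg_conn_fps_compose deg_conn_fps_refl)
  have S2: "prob_deg_stirling2 M Y lam n k = fact n * fps_nth (P ^ k) n / fact k" for k
    by (simp only: prob_deg_stirling2_def egf_coeff_power[OF P])
  have S1: "(-1) ^ (n - k) * prob_deg_stirling1 M Y lam n k =
      fact n * fps_nth (G ^ k) n / fact k" for k
    by (simp only: prob_deg_stirling1_def egf_coeff_power[OF G])
       (simp flip: mult.assoc power_mult_distrib)
  have "prob_deg_stirling2 M Y lam n l =
      (\<Sum>k=l..n. (-1) ^ (n - k) * prob_deg_stirling1 M Y lam n k * deg_stirling2 (-lam) k l)"
    unfolding S1 S2 deg_stirling2_eq_fps
    using fps_power_compose_coeff[OF G0, of "deg_conn_fps (-lam) 1" n l] by (simp add: PG)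
  moreover have "(-1) ^ (n - l) * prob_deg_stirling1 M Y lam n l =
      (\<Sum>k=l..n. prob_deg_stirling2 M Y lam n k * deg_stirling1 (-lam) k l)"
    unfolding S1 S2
    using assms(4) fps_power_compose_coeff[OF P0, of "deg_conn_fps 1 (-lam)" n l]
    by (simp add: G_def deg_stirling1_eq_fps)
  ultimately show ?thesis ..
qed

end
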